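(* Let $(X,d)$ be a compact metric space, let $\mu,\nu\in\mathcal{P}(X)$ with $\operatorname{supp}(\mu)=\operatorname{supp}(\nu)=X$, and let $c(x,y)=d(x,y)$ on $X\times X$. For each $\beta>0$ let $\varphi_\beta,\psi_\beta\in C(X)$ be a pair of functions satisfying $$\int_X e^{-\beta d(x,y)+\varphi_\beta(x)+\psi_\beta(y)}\,d\mu(x)=1\quad\forall y\in X\qquad\text{and}\qquad \int_X e^{-\beta d(x,y)+\varphi_\beta(x)+\psi_\beta(y)}\,d\nu(y)=1\quad\forall x\in X.$$ If $\beta_n\to+\infty$ and $\frac{\varphi_{\beta_n}}{\beta_n}$ converges uniformly to a function $\varphi$, then $\varphi$ is a solution of the Kantorovich-Rubinstein dual problem, that is, $\operatorname{Lip}(\varphi)\le 1$ and $$\alpha(c)=\int\varphi\,d(\mu-\nu).$$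
   Context: $\mathcal{P}(X)$ denotes the Borel probabilities on $X$, $C(X)$ the continuous real functions on $X$, and $\operatorname{Lip}(f)$ the (best) Lipschitz constant of $f$. $\Pi(\mu,\nu)$ is the set of probabilities on $X\times X$ with first marginal $\mu$ and second marginal $\nu$, and $\alpha(c)=\min_{\pi\in\Pi(\mu,\nu)}\int c\,d\pi$. For each $\beta>0$ a pair $(\varphi_\beta,\psi_\beta)$ as in the claim exists and is unique up to replacing it by $(\varphi_\beta+d_\beta,\psi_\beta-d_\beta)$ with $d_\beta\in\mathbb{R}$ a constant. *)

theory Defs
  imports "HOL-Probability.Probability"
begin

definition borel_probs :: "'a::topological_space measure set" where
  "borel_probs = {M. prob_space M \<and> sets M = sets borel}"

definition measure_supp :: "'a::topological_space measure \<Rightarrow> 'a set" where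
  "measure_supp M = {x. \<forall>U. open U \<longrightarrow> x \<in> U \<longrightarrow> emeasure M U > 0}"

definition couplings ::
    "'a::topological_space measure \<Rightarrow> 'a measure \<Rightarrow> ('a \<times> 'a) measure set" where
  "couplings \<mu> \<nu> = {\<pi> \<in> borel_probs. distr \<pi> borel fst = \<mu> \<and> distr \<pi> borel snd = \<nu>}"

text \<open>
  The value \<open>\<alpha>(c)\<close> is a minimum, not just an infimum, hence \<open>LEAST\<close>. It determines a value
  only where the minimum is attained, as it is for continuous \<open>c\<close> and Borel probabilities
  \<open>\<mu>\<close>, \<open>\<nu>\<close> on a compact metric space.
\<close>
definition transport_cost ::
    "('a::topological_space \<Rightarrow> 'a \<Rightarrow> real) \<Rightarrow> 'a measure \<Rightarrow> 'a measure \<Rightarrow> real" where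
  "transport_cost c \<mu> \<nu> =
     (LEAST r. r \<in> (\<lambda>\<pi>. \<integral>z. c (fst z) (snd z) \<partial>\<pi>) ` couplings \<mu> \<nu>)"

text \<open>
  The best Lipschitz constant is extended-real valued: it is \<open>\<infinity>\<close> for functions that are not
  Lipschitz, whereas the real infimum of the empty set could be any number.
\<close>
definition Lip :: "('a::metric_space \<Rightarrow> real) \<Rightarrow> ereal" where
  "Lip f = (INF L \<in> {L. L-lipschitz_on UNIV f}. ereal L)"

end

theory Submission
  imports Defs
begin

text \<open>
  The entropic problem supplies, for each inverse temperature \<open>\<beta>\<close>, both an explicit transport plan
  \<open>\<pi>\<^sub>\<beta> = exp (- \<beta> d + \<phi>\<^sub>\<beta> + \<psi>\<^sub>\<beta>) \<mu> \<otimes> \<nu>\<close> and a nearly admissible pair of dual potentials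
  \<open>\<phi>\<^sub>\<beta> / \<beta>\<close>, \<open>\<psi>\<^sub>\<beta> / \<beta>\<close>. Three estimates show that both are nearly optimal when \<open>\<beta>\<close> is large.

  \<^item> The triangle inequality, inserted into the normalisation over \<open>\<nu>\<close>, makes \<open>\<phi>\<^sub>\<beta> / \<beta>\<close>
    1-Lipschitz (\<open>potential_lipschitz\<close>); so is its limit \<open>\<phi>\<close>. Integrating
    \<open>\<phi> x - \<phi> y \<le> d(x, y)\<close> against a coupling bounds every transport cost below by
    \<open>\<integral>\<phi> d(\<mu> - \<nu>)\<close> (\<open>lipschitz_dual_le_transport\<close>).

  \<^item> Restricting the normalisation over \<open>\<mu>\<close> to a ball of radius \<open>r\<close> about \<open>y\<close> gives
    \<open>\<phi>\<^sub>\<beta> y + \<psi>\<^sub>\<beta> y \<le> 2 \<beta> r - ln (\<mu> (ball y r))\<close> (\<open>potentials_sum_le\<close>). Since \<open>\<mu>\<close> has full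
    support on a compact space, its mass on balls of radius \<open>r\<close> is bounded away from 0
    (\<open>full_support_balls_bounded_below\<close>), so after division by \<open>\<beta>\<close> the logarithm disappears in the
    limit and \<open>\<psi>\<^sub>\<beta> / \<beta>\<close> is asymptotically at most \<open>- \<phi>\<close>.

  \<^item> With \<open>h = \<beta> d - \<phi>\<^sub>\<beta> - \<psi>\<^sub>\<beta>\<close> the plan has density \<open>exp (- h)\<close>, and \<open>h exp (- h) \<le> 1\<close>. Hence
    \<open>\<beta> \<integral>d d\<pi>\<^sub>\<beta> \<le> \<integral>\<phi>\<^sub>\<beta> d\<mu> + \<integral>\<psi>\<^sub>\<beta> d\<nu> + 1\<close> (\<open>plan_cost\<close>).

  Together these give \<open>limsup \<integral>d d\<pi>\<^sub>\<beta> \<le> \<integral>\<phi> d(\<mu> - \<nu>)\<close> as \<open>\<beta>\<close> runs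
  through the sequence \<open>\<beta> n\<close>. A weak limit of the plans along a subsequence
  is a coupling that attains the lower bound, so the minimal cost exists and equals
  \<open>\<integral>\<phi> d(\<mu> - \<nu>)\<close>.

  The weak limit comes from sequential compactness of the Borel probabilities on a compact metric
  space (\<open>compact_space_weak_convergent_subsequence\<close>), which is reduced to Helly's theorem on the
  real line: the space is coded injectively by reals, and although the code is only
  Borel measurable, its inverse is uniformly continuous, which is what is needed to bring limits back.
\<close>

section \<open>Borel sets of compact metric spaces\<close>

lemma compact_space_continuous_integrable:
  fixes f :: "'a::metric_space \<Rightarrow> real"
  assumes "compact (UNIV :: 'a set)" "M \<in> borel_probs" "continuous_on UNIV f"
  shows "integrable M f"
proof -
  interpret prob_space M using assms by (simp add: borel_probs_def)
  have "bounded (range f)"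
    using assms compact_continuous_image compact_imp_bounded by blast
  then obtain B where B: "\<And>x. norm (f x) \<le> B"
    by (auto simp: bounded_iff)
  have "f \<in> borel_measurable M"
    using borel_measurable_continuous_onI[OF assms(3)] assms(2) measurable_cong_sets[of M borel borel borel]
    by (auto simp: borel_probs_def)
  then show ?thesis
    using B by (intro integrable_const_bound[where B=B]) auto
qed

text \<open>
  These sets form in particular a countable base. The stronger property, that finitely many of
  its members of diameter at most \<open>\<epsilon>\<close> already cover the space, makes the coding below invertible in a
  uniformly continuous way.
\<close>
lemma compact_space_fine_open_cover:
  assumes "compact (UNIV :: 'a::metric_space set)"
  obtains B :: "nat \<Rightarrow> 'a::metric_space set" where "\<And>j. open (B j)"
    "\<And>\<epsilon>. \<epsilon> > 0 \<Longrightarrow> \<exists>J. \<forall>z. \<exists>j<J. z \<in> B j \<and> (\<forall>x\<in>B j. \<forall>y\<in>B j. dist x y < \<epsilon>)"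
proof -
  have "\<forall>\<epsilon>>0. \<exists>k. finite k \<and> UNIV \<subseteq> (\<Union>x\<in>k. ball (x::'a) \<epsilon>)"
    using assms compact_eq_totally_bounded by blast
  then obtain k where fin: "\<And>\<epsilon>. \<epsilon> > 0 \<Longrightarrow> finite (k \<epsilon>)"
    and cov: "\<And>\<epsilon>. \<epsilon> > 0 \<Longrightarrow> UNIV \<subseteq> (\<Union>x\<in>k \<epsilon>. ball (x::'a) \<epsilon>)"
    by metis
  define F where "F = (\<lambda>n::nat. (\<lambda>x. ball x (1 / Suc n)) ` k (1 / Suc n))"
  have finF: "finite (F n)" for n
    unfolding F_def using fin by auto
  define C where "C = (\<Union>n. F n)"
  have "countable C"
    unfolding C_def using finF by (auto intro: countable_finite)
  moreover have "C \<noteq> {}"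
    using cov[of 1] unfolding C_def F_def by (auto intro!: exI[of _ 0])
  ultimately have rng: "range (from_nat_into C) = C"
    by (rule range_from_nat_into[rotated])
  show thesis
  proof (rule that[of "from_nat_into C"])
    fix j show "open (from_nat_into C j)"
      using from_nat_into[OF \<open>C \<noteq> {}\<close>, of j] by (auto simp: C_def F_def)
  next
    fix \<epsilon> :: real assume "\<epsilon> > 0"
    then obtain n where n: "1 / Suc n < \<epsilon> / 2"
      using nat_approx_posE[of "\<epsilon> / 2"] by auto
    have "\<exists>N. F n = from_nat_into C ` N \<and> finite N"
      using finite_subset_image[OF finF[of n], of "from_nat_into C" UNIV] rng C_def by auto
    then obtain N where N: "F n = from_nat_into C ` N" "finite N" by auto
    then obtain J where J: "\<forall>j\<in>N. j < J"
      using finite_nat_set_iff_bounded by auto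
    show "\<exists>J. \<forall>z. \<exists>j<J. z \<in> from_nat_into C j \<and>
        (\<forall>x\<in>from_nat_into C j. \<forall>y\<in>from_nat_into C j. dist x y < \<epsilon>)"
    proof (rule exI[of _ J], rule allI)
      fix z
      obtain c where c: "c \<in> k (1 / Suc n)" "z \<in> ball c (1 / Suc n)"
        using cov[of "1 / Suc n"] by fastforce
      then have "ball c (1 / Suc n) \<in> F n" by (auto simp: F_def)
      then obtain j where j: "j \<in> N" "from_nat_into C j = ball c (1 / Suc n)"
        using N by auto
      have "dist x y < \<epsilon>" if "x \<in> ball c (1 / Suc n)" "y \<in> ball c (1 / Suc n)" for x y
        using dist_triangle3[of x y c] n that by auto
      then show "\<exists>j<J. z \<in> from_nat_into C j \<and>
        (\<forall>x\<in>from_nat_into C j. \<forall>y\<in>from_nat_into C j. dist x y < \<epsilon>)"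
        using j J c by auto
    qed
  qed
qed

text \<open>
  Without a countable base the Borel sets of the square can be strictly more. Compactness provides
  one: open sets of the square are countable unions of rectangles \<open>B i \<times> B j\<close> taken from the fine cover.
\<close>
lemma sets_borel_prod_compact_space:
  assumes "compact (UNIV :: 'a::metric_space set)"
  shows "sets (borel \<Otimes>\<^sub>M borel) = sets (borel :: ('a \<times> 'a) measure)"
proof
  obtain B :: "nat \<Rightarrow> 'a set" where B: "\<And>j. open (B j)"
    "\<And>\<epsilon>. \<epsilon> > 0 \<Longrightarrow> \<exists>J. \<forall>z. \<exists>j<J. z \<in> B j \<and> (\<forall>x\<in>B j. \<forall>y\<in>B j. dist x y < \<epsilon>)"
    using compact_space_fine_open_cover[OF assms] by blast
  have open_meas: "U \<in> sets (borel \<Otimes>\<^sub>M borel)" if "open U" for U :: "('a \<times> 'a) set"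
  proof -
    have "\<exists>i j. fst z \<in> B i \<and> snd z \<in> B j \<and> B i \<times> B j \<subseteq> U" if "z \<in> U" for z
    proof -
      obtain x y where z: "z = (x, y)" by (cases z)
      obtain V W where VW: "open V" "open W" "x \<in> V" "y \<in> W" "V \<times> W \<subseteq> U"
        using open_prod_elim[OF \<open>open U\<close> \<open>z \<in> U\<close>] z by (metis mem_Sigma_iff)
      have "\<exists>i. x \<in> B i \<and> B i \<subseteq> V" if "open V" "x \<in> V" for V and x :: 'a
      proof -
        obtain e where e: "e > 0" "ball x e \<subseteq> V" using \<open>open V\<close> \<open>x \<in> V\<close> openE by blast
        with B(2)[of e] obtain j where "x \<in> B j" "\<forall>x\<in>B j. \<forall>y\<in>B j. dist x y < e" by blast
        then show ?thesis using e by (intro exI[of _ j]) auto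
      qed
      with VW obtain i j where ij: "x \<in> B i" "B i \<subseteq> V" "y \<in> B j" "B j \<subseteq> W" by metis
      then have "B i \<times> B j \<subseteq> U" using VW(5) by blast
      then show ?thesis using ij z by auto
    qed
    then have "U = (\<Union>i. \<Union>j. if B i \<times> B j \<subseteq> U then B i \<times> B j else {})"
      by (fastforce split: if_splits)
    also have "\<dots> \<in> sets (borel \<Otimes>\<^sub>M borel)"
      using B(1) by (intro sets.countable_UN) (auto intro!: sets.countable_UN)
    finally show ?thesis .
  qed
  then have "sigma_sets (space ((borel :: 'a measure) \<Otimes>\<^sub>M (borel :: 'a measure))) (Collect open)
      \<subseteq> sets ((borel :: 'a measure) \<Otimes>\<^sub>M (borel :: 'a measure))"
    using open_meas by (intro sets.sigma_sets_subset subsetI) simp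
  then show "sets (borel :: ('a \<times> 'a) measure) \<subseteq> sets (borel \<Otimes>\<^sub>M borel)"
    by (simp add: sets_borel space_pair_measure)
next
  have "A \<times> C \<in> sets borel" if "A \<in> sets borel" "C \<in> sets borel" for A C :: "'a set"
  proof -
    have "A \<times> C = fst -` A \<inter> snd -` C" by auto
    moreover have "fst -` A \<in> sets borel" "snd -` C \<in> sets borel"
      using that measurable_sets[OF borel_measurable_continuous_onI[OF continuous_on_fst[OF continuous_on_id]], of A]
        measurable_sets[OF borel_measurable_continuous_onI[OF continuous_on_snd[OF continuous_on_id]], of C]
      by auto
    ultimately show ?thesis by auto
  qed
  then have "sigma_sets (space (borel :: ('a \<times> 'a) measure))
      {A \<times> C | A C. A \<in> sets (borel :: 'a measure) \<and> C \<in> sets (borel :: 'a measure)} \<subseteq> sets borel"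
    by (intro sets.sigma_sets_subset) auto
  then show "sets (borel \<Otimes>\<^sub>M borel) \<subseteq> sets (borel :: ('a \<times> 'a) measure)"
    by (simp add: sets_pair_measure)
qed

section \<open>Coding a compact metric space by real numbers\<close>

text \<open>
  Applied to the difference of two digit sequences with digits 0 and 1. In base 3 the first
  differing digit outweighs all later ones, so, unlike in base 2, close numbers share their leading
  digits.
\<close>
lemma ternary_expansion_first_digit:
  fixes a :: "nat \<Rightarrow> real"
  assumes bd: "\<And>i. \<bar>a i\<bar> \<le> 1" and zero: "\<And>i. i < n \<Longrightarrow> a i = 0" and one: "\<bar>a n\<bar> = 1"
  shows "(1/3) ^ n / 2 \<le> \<bar>\<Sum>i. a i * (1/3) ^ i\<bar>"
proof -
  have geo: "summable (\<lambda>i. (1/3::real) ^ i)" by simp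
  have sm: "summable (\<lambda>i. a i * (1/3) ^ i)"
    by (rule summable_comparison_test'[OF geo, of 0]) (use bd in \<open>auto simp: abs_mult intro: mult_left_le_one_le\<close>)
  have gk: "summable (\<lambda>k. (1/3::real) ^ (k + Suc n))"
    using summable_iff_shift geo by blast
  have "\<bar>\<Sum>k. a (k + Suc n) * (1/3) ^ (k + Suc n)\<bar> \<le> (\<Sum>k. (1/3::real) ^ (k + Suc n))"
    using norm_suminf_le[OF _ gk, of "\<lambda>k. a (k + Suc n) * (1/3) ^ (k + Suc n)"] bd
    by (auto simp: abs_mult intro!: mult_left_le_one_le)
  also have "\<dots> = (\<Sum>k. (1/3) ^ Suc n * (1/3::real) ^ k)"
    by (simp add: power_add mult_ac)
  also have "\<dots> = (1/3) ^ n / 2"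
    using suminf_mult[OF geo, of "(1/3) ^ Suc n"] by (simp add: suminf_geometric)
  finally have tail: "\<bar>\<Sum>k. a (k + Suc n) * (1/3) ^ (k + Suc n)\<bar> \<le> (1/3) ^ n / 2" .
  have "(\<Sum>i. a i * (1/3) ^ i) = (\<Sum>k. a (k + Suc n) * (1/3) ^ (k + Suc n)) + (\<Sum>i<Suc n. a i * (1/3) ^ i)"
    by (rule suminf_split_initial_segment[OF sm])
  also have "(\<Sum>i<Suc n. a i * (1/3) ^ i) = a n * (1/3) ^ n"
    using zero by simp
  finally have "(\<Sum>i. a i * (1/3) ^ i) = (\<Sum>k. a (k + Suc n) * (1/3) ^ (k + Suc n)) + a n * (1/3) ^ n" .
  moreover have "\<bar>a n * (1/3) ^ n\<bar> = (1/3) ^ n" using one by (simp add: abs_mult)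
  ultimately show ?thesis using tail by linarith
qed

text \<open>
  The \<open>i\<close>-th ternary digit of the code of \<open>z\<close> says whether \<open>z\<close> lies in the \<open>i\<close>-th set of a fine
  cover. Points with close codes agree on the first \<open>J\<close> digits, hence lie in a common small set.
\<close>
lemma compact_space_real_code:
  assumes "compact (UNIV :: 'a::metric_space set)"
  obtains s :: "'a::metric_space \<Rightarrow> real" where "s \<in> borel_measurable borel" "range s \<subseteq> {0..3/2}"
    "\<And>\<epsilon>. \<epsilon> > 0 \<Longrightarrow> \<exists>\<delta>>0. \<forall>x y. \<bar>s x - s y\<bar> < \<delta> \<longrightarrow> dist x y < \<epsilon>"
proof -
  obtain B :: "nat \<Rightarrow> 'a set" where B: "\<And>j. open (B j)"
    "\<And>\<epsilon>. \<epsilon> > 0 \<Longrightarrow> \<exists>J. \<forall>z. \<exists>j<J. z \<in> B j \<and> (\<forall>x\<in>B j. \<forall>y\<in>B j. dist x y < \<epsilon>)"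
    using compact_space_fine_open_cover[OF assms] by blast
  define s where "s z = (\<Sum>i. indicator (B i) z * (1/3::real) ^ i)" for z
  have geo: "summable (\<lambda>i. (1/3::real) ^ i)" by simp
  have sm: "summable (\<lambda>i. indicator (B i) z * (1/3::real) ^ i)" for z
    by (rule summable_comparison_test'[OF geo, of 0]) (auto simp: indicator_def)
  show thesis
  proof
    have [measurable]: "B i \<in> sets borel" for i using B(1) by simp
    show "s \<in> borel_measurable borel"
      unfolding s_def by measurable
  next
    have "0 \<le> s z" for z unfolding s_def by (intro suminf_nonneg sm) auto
    moreover have "s z \<le> 3/2" for z
      using suminf_le[OF _ sm geo, of z] unfolding s_def
      by (auto simp: suminf_geometric indicator_def)
    ultimately show "range s \<subseteq> {0..3/2}" by auto
  next
    fix \<epsilon> :: real assume "\<epsilon> > 0"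
    then obtain J where J: "\<forall>z. \<exists>j<J. z \<in> B j \<and> (\<forall>x\<in>B j. \<forall>y\<in>B j. dist x y < \<epsilon>)"
      using B(2) by blast
    have "dist x y < \<epsilon>" if "\<bar>s x - s y\<bar> < (1/3) ^ J / 2" for x y
    proof (rule ccontr)
      assume "\<not> dist x y < \<epsilon>"
      with J obtain j where j: "j < J" "x \<in> B j" "y \<notin> B j" by blast
      define a where "a i = (indicator (B i) x - indicator (B i) y :: real)" for i
      define n where "n = (LEAST i. a i \<noteq> 0)"
      have aj: "a j \<noteq> 0" using j by (simp add: a_def)
      have an: "a n \<noteq> 0" unfolding n_def by (rule LeastI[of "\<lambda>i. a i \<noteq> 0", OF aj])
      have "n \<le> j" unfolding n_def by (rule Least_le[of "\<lambda>i. a i \<noteq> 0", OF aj])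
      have "s x - s y = (\<Sum>i. a i * (1/3) ^ i)"
        unfolding s_def a_def by (subst suminf_diff[OF sm sm]) (simp add: left_diff_distrib)
      moreover have "(1/3) ^ n / 2 \<le> \<bar>\<Sum>i. a i * (1/3) ^ i\<bar>"
      proof (rule ternary_expansion_first_digit)
        show "\<bar>a i\<bar> \<le> 1" for i by (auto simp: a_def indicator_def)
        show "a i = 0" if "i < n" for i using not_less_Least that unfolding n_def by blast
        show "\<bar>a n\<bar> = 1" using an by (auto simp: a_def indicator_def split: if_splits)
      qed
      moreover have "(1/3::real) ^ J \<le> (1/3) ^ n"
        using \<open>n \<le> j\<close> j by (intro power_decreasing) auto
      ultimately show False using that by linarith
    qed
    then show "\<exists>\<delta>>0. \<forall>x y. \<bar>s x - s y\<bar> < \<delta> \<longrightarrow> dist x y < \<epsilon>"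
      by (intro exI[of _ "(1/3) ^ J / 2"]) auto
  qed
qed

text \<open>
  The uniformly continuous inverse of the code extends to the closure of the range, because
  compactness supplies the limit points. On the closure, which is a Borel set, decoding is a
  genuine continuous map; the range itself need not be closed.
\<close>
lemma compact_space_decoding_extends:
  fixes s :: "'a::metric_space \<Rightarrow> real"
  assumes "compact (UNIV :: 'a set)"
    and s: "\<And>\<epsilon>. \<epsilon> > 0 \<Longrightarrow> \<exists>\<delta>>0. \<forall>x y. \<bar>s x - s y\<bar> < \<delta> \<longrightarrow> dist x y < \<epsilon>"
  shows "\<exists>g. continuous_on (closure (range s)) g \<and> (\<forall>z. g (s z) = z)"
proof -
  \<comment> \<open>\<open>lim t z\<close>: points whose codes approach \<open>t\<close> converge to \<open>z\<close>.\<close>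
  define lim where "lim t z \<longleftrightarrow> (\<forall>\<epsilon>>0. \<exists>\<delta>>0. \<forall>x. \<bar>s x - t\<bar> < \<delta> \<longrightarrow> dist x z < \<epsilon>)" for t z
  have "\<exists>z. lim t z" if "t \<in> closure (range s)" for t
  proof -
    from that obtain q where q: "\<And>n. q n \<in> range s" "q \<longlonglongrightarrow> t"
      unfolding closure_sequential by blast
    have "\<forall>n. \<exists>x. q n = s x" using q(1) by blast
    then obtain p where p: "\<And>n. q n = s (p n)" by metis
    obtain z r where r: "strict_mono (r :: nat \<Rightarrow> nat)" "(p \<circ> r) \<longlonglongrightarrow> z"
      using assms(1) unfolding compact_def by (metis UNIV_I)
    have "lim t z" unfolding lim_def
    proof (intro allI impI)
      fix \<epsilon> :: real assume "\<epsilon> > 0"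
      then obtain \<delta> where \<delta>: "\<delta> > 0" "\<And>x y. \<bar>s x - s y\<bar> < \<delta> \<Longrightarrow> dist x y < \<epsilon> / 2"
        using s[of "\<epsilon> / 2"] by auto
      have "(\<lambda>n. s (p (r n))) \<longlonglongrightarrow> t"
        using LIMSEQ_subseq_LIMSEQ[OF q(2) r(1)] by (simp add: p comp_def)
      from tendstoD[OF this, of "\<delta> / 2"] tendstoD[OF r(2), of "\<epsilon> / 2"] \<open>\<delta> > 0\<close> \<open>\<epsilon> > 0\<close>
      have "\<forall>\<^sub>F n in sequentially. dist (s (p (r n))) t < \<delta> / 2 \<and> dist (p (r n)) z < \<epsilon> / 2"
        by (auto intro: eventually_conj)
      then obtain n where n: "\<bar>s (p (r n)) - t\<bar> < \<delta> / 2" "dist (p (r n)) z < \<epsilon> / 2"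
        by (auto simp: eventually_sequentially dist_real_def)
      have "dist x z < \<epsilon>" if "\<bar>s x - t\<bar> < \<delta> / 2" for x
      proof -
        have "dist x (p (r n)) < \<epsilon> / 2" using that n by (intro \<delta>(2)) linarith
        then show ?thesis using n(2) dist_triangle[of x z "p (r n)"] by linarith
      qed
      then show "\<exists>\<delta>>0. \<forall>x. \<bar>s x - t\<bar> < \<delta> \<longrightarrow> dist x z < \<epsilon>"
        using \<open>\<delta> > 0\<close> by (intro exI[of _ "\<delta> / 2"]) auto
    qed
    then show ?thesis ..
  qed
  then obtain g where g: "\<And>t. t \<in> closure (range s) \<Longrightarrow> lim t (g t)" by metis
  show ?thesis
  proof (intro exI[of _ g] conjI allI)
    show "g (s z) = z" for z
    proof (rule ccontr)
      assume "g (s z) \<noteq> z"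
      moreover have "lim (s z) (g (s z))"
        using closure_subset[of "range s"] by (intro g) auto
      ultimately show False
        unfolding lim_def by (metis abs_zero cancel_comm_monoid_add_class.diff_cancel dist_commute
            less_irrefl zero_less_dist_iff)
    qed
    show "continuous_on (closure (range s)) g" unfolding continuous_on_iff
    proof (intro ballI allI impI)
      fix t and \<epsilon> :: real assume t: "t \<in> closure (range s)" and "\<epsilon> > 0"
      with g[OF t] obtain \<delta> where \<delta>: "\<delta> > 0" "\<And>x. \<bar>s x - t\<bar> < \<delta> \<Longrightarrow> dist x (g t) < \<epsilon> / 2"
        unfolding lim_def by (meson half_gt_zero)
      have "dist (g t') (g t) < \<epsilon>" if t': "t' \<in> closure (range s)" "dist t' t < \<delta> / 2" for t'
      proof -
        obtain \<delta>' where \<delta>': "\<delta>' > 0" "\<And>x. \<bar>s x - t'\<bar> < \<delta>' \<Longrightarrow> dist x (g t') < \<epsilon> / 2"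
          using g[OF t'(1)] \<open>\<epsilon> > 0\<close> unfolding lim_def by (meson half_gt_zero)
        obtain x where x: "dist (s x) t' < min \<delta>' (\<delta> / 2)"
          using t'(1) \<delta>(1) \<delta>'(1) unfolding closure_approachable
          by (metis half_gt_zero imageE min_less_iff_conj)
        then have "\<bar>s x - t'\<bar> < \<delta>'" "\<bar>s x - t\<bar> < \<delta>"
          using t'(2) unfolding dist_real_def by linarith+
        then have "dist x (g t') < \<epsilon> / 2" "dist x (g t) < \<epsilon> / 2"
          using \<delta>'(2) \<delta>(2) by auto
        then show ?thesis using dist_triangle3[of "g t'" "g t" x] by linarith
      qed
      then show "\<exists>d>0. \<forall>x'\<in>closure (range s). dist x' t < d \<longrightarrow> dist (g x') (g t) < \<epsilon>"
        using \<delta>(1) by (intro exI[of _ "\<delta> / 2"]) auto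
    qed
  qed
qed

section \<open>Weak compactness of Borel probabilities\<close>

text \<open>
  All continuous test functions are admitted, rather than the bounded ones; on a compact
  space the two notions agree.
\<close>
definition weakly_converges :: "(nat \<Rightarrow> 'a::topological_space measure) \<Rightarrow> 'a measure \<Rightarrow> bool" where
  "weakly_converges M N \<longleftrightarrow>
     (\<forall>f :: 'a \<Rightarrow> real. continuous_on UNIV f \<longrightarrow> (\<lambda>n. \<integral>z. f z \<partial>M n) \<longlonglongrightarrow> (\<integral>z. f z \<partial>N))"

text \<open>
  Push the measures to the real line by the code. Helly's theorem selects a weakly convergent
  subsequence there, and Skorohod's theorem realises it by pointwise convergent random variables.
  These take values in the closure of the set of codes, where decoding is continuous, so the decoded
  variables converge pointwise as well; they have the original distributions, and the distribution
  of their limit is the required measure.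
\<close>
theorem compact_space_weak_convergent_subsequence:
  fixes M :: "nat \<Rightarrow> 'a::metric_space measure"
  assumes cpt: "compact (UNIV :: 'a set)" and M: "\<And>n. M n \<in> borel_probs"
  obtains r N where "strict_mono (r :: nat \<Rightarrow> nat)" "N \<in> borel_probs"
    "weakly_converges (M \<circ> r) N"
proof -
  obtain s :: "'a \<Rightarrow> real" where s_meas: "s \<in> borel_measurable borel" and s_rng: "range s \<subseteq> {0..3/2}"
    and s_inv: "\<And>\<epsilon>. \<epsilon> > 0 \<Longrightarrow> \<exists>\<delta>>0. \<forall>x y. \<bar>s x - s y\<bar> < \<delta> \<longrightarrow> dist x y < \<epsilon>"
    by (rule compact_space_real_code[OF cpt]) blast
  obtain g where g_cont: "continuous_on (closure (range s)) g" and gs: "\<And>z. g (s z) = z"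
    using compact_space_decoding_extends[OF cpt, of s] s_inv by auto
  define C where "C = closure (range s)"
  have sC: "s z \<in> C" for z unfolding C_def using closure_subset[of "range s"] by (rule subsetD) simp
  \<comment> \<open>The value outside \<open>C\<close> is arbitrary, as all relevant variables stay in \<open>C\<close> almost surely.\<close>
  define h where "h t = (if t \<in> C then g t else undefined)" for t
  have h_meas[measurable]: "h \<in> borel_measurable borel"
    unfolding h_def C_def using g_cont by (intro borel_measurable_continuous_on_if) auto
  have h_cont: "continuous_on C h"
    using g_cont unfolding C_def h_def by (auto cong: continuous_on_cong)
  have hs: "h (s z) = z" for z by (simp add: h_def sC gs)

  interpret M: prob_space "M n" for n using M by (simp add: borel_probs_def)
  have M_sets[measurable_cong]: "sets (M n) = sets borel" for n using M by (simp add: borel_probs_def)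
  note s_meas[measurable]
  define R where "R n = distr (M n) borel s" for n
  have R: "real_distribution (R n)" for n
    unfolding R_def by (rule M.real_distribution_distr) measurable
  \<comment> \<open>Tightness is immediate, since all codes lie in \<open>{0..3/2}\<close>.\<close>
  have "measure (R n) {-1<..2} = 1" for n
  proof -
    have "s -` {-1<..2} \<inter> space (M n) = space (M n)"
    proof -
      have "s z \<in> {-1<..2}" for z using s_rng rangeI[of s z] by fastforce
      then show ?thesis by blast
    qed
    then show ?thesis unfolding R_def by (subst measure_distr) (auto simp: M.prob_space)
  qed
  then have "tight R" unfolding tight_def using R by (intro conjI allI impI exI[of _ "-1::real"] exI[of _ "2::real"]; simp)
  from tight_imp_convergent_subsubsequence[OF this strict_mono_id]
  obtain r L where r: "strict_mono (r :: nat \<Rightarrow> nat)" and L: "real_distribution L"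
    and conv: "weak_conv_m (R \<circ> r) L"
    by auto
  have Rr: "real_distribution ((R \<circ> r) n)" for n using R by simp
  obtain \<Omega> :: "real measure" and Yn :: "nat \<Rightarrow> real \<Rightarrow> real" and Y where
    Om: "prob_space \<Omega>" and Yn[measurable]: "\<And>n. Yn n \<in> borel_measurable \<Omega>"
    and dYn: "\<And>n. distr \<Omega> borel (Yn n) = R (r n)"
    and Y[measurable]: "Y \<in> borel_measurable \<Omega>"
    and YY: "\<And>\<omega>. \<omega> \<in> space \<Omega> \<Longrightarrow> (\<lambda>n. Yn n \<omega>) \<longlonglongrightarrow> Y \<omega>"
    using Skorohod[OF Rr L conv] unfolding comp_def by force
  interpret \<Omega>: prob_space \<Omega> by (rule Om)
  have dZn: "distr \<Omega> borel (\<lambda>\<omega>. h (Yn n \<omega>)) = M (r n)" for n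
  proof -
    have "distr \<Omega> borel (\<lambda>\<omega>. h (Yn n \<omega>)) = distr (R (r n)) borel h"
      unfolding dYn[symmetric] by (subst distr_distr) (auto simp: comp_def)
    also have "\<dots> = distr (M (r n)) borel (\<lambda>z. h (s z))"
      unfolding R_def by (subst distr_distr) (auto simp: comp_def)
    also have "\<dots> = M (r n)"
      unfolding hs by (rule distr_id2) (simp add: M_sets)
    finally show ?thesis .
  qed
  have "AE \<omega> in \<Omega>. Yn n \<omega> \<in> C" for n
  proof -
    have [measurable]: "C \<in> sets borel" by (simp add: C_def)
    have "AE t in R (r n). t \<in> C"
      unfolding R_def by (subst AE_distr_iff) (auto simp: sC)
    then show ?thesis
      unfolding dYn[symmetric] by (subst (asm) AE_distr_iff) auto
  qed
  then have AE_C: "AE \<omega> in \<Omega>. \<forall>n. Yn n \<omega> \<in> C" by (simp add: AE_all_countable)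
  define N where "N = distr \<Omega> borel (\<lambda>\<omega>. h (Y \<omega>))"
  show thesis
  proof
    show "strict_mono r" by fact
    show "N \<in> borel_probs"
      unfolding borel_probs_def N_def by (auto intro!: \<Omega>.prob_space_distr)
    show "weakly_converges (M \<circ> r) N" unfolding weakly_converges_def
    proof (intro allI impI)
      fix f :: "'a \<Rightarrow> real" assume f: "continuous_on UNIV f"
      then have f_meas[measurable]: "f \<in> borel_measurable borel"
        by (rule borel_measurable_continuous_onI)
      have "bounded (range f)"
        using f cpt compact_continuous_image compact_imp_bounded by blast
      then obtain K where K: "\<And>x. norm (f x) \<le> K"
        by (auto simp: bounded_iff)
      have "(\<lambda>n. \<integral>\<omega>. f (h (Yn n \<omega>)) \<partial>\<Omega>) \<longlonglongrightarrow> (\<integral>\<omega>. f (h (Y \<omega>)) \<partial>\<Omega>)"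
      proof (rule integral_dominated_convergence[where w="\<lambda>_. K"])
        show "AE \<omega> in \<Omega>. (\<lambda>n. f (h (Yn n \<omega>))) \<longlonglongrightarrow> f (h (Y \<omega>))"
          using AE_C AE_space
        proof eventually_elim
          case (elim \<omega>)
          have "Y \<omega> \<in> C"
            using closed_sequentially[of C "\<lambda>n. Yn n \<omega>" "Y \<omega>"] elim YY by (auto simp: C_def)
          then have "(\<lambda>n. h (Yn n \<omega>)) \<longlonglongrightarrow> h (Y \<omega>)"
            using elim YY by (intro continuous_on_tendsto_compose[OF h_cont]) auto
          then show ?case
            by (intro continuous_on_tendsto_compose[OF f]) auto
        qed
      qed (use K in auto)
      moreover have "(\<integral>\<omega>. f (h (Yn n \<omega>)) \<partial>\<Omega>) = (\<integral>z. f z \<partial>M (r n))" for n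
        unfolding dZn[symmetric] by (subst integral_distr) auto
      moreover have "(\<integral>\<omega>. f (h (Y \<omega>)) \<partial>\<Omega>) = (\<integral>z. f z \<partial>N)"
        unfolding N_def by (subst integral_distr) auto
      ultimately show "(\<lambda>n. \<integral>z. f z \<partial>(M \<circ> r) n) \<longlonglongrightarrow> (\<integral>z. f z \<partial>N)" by simp
    qed
  qed
qed

text \<open>
  The indicator of a nonempty closed set \<open>F\<close> is the decreasing limit of the continuous functions
  \<open>max 0 (1 - k infdist x F)\<close>, and the closed sets form an intersection-stable generator.
\<close>
lemma borel_probs_eqI_continuous:
  fixes M N :: "'a::metric_space measure"
  assumes M: "M \<in> borel_probs" and N: "N \<in> borel_probs"
    and eq: "\<And>f :: 'a \<Rightarrow> real. continuous_on UNIV f \<Longrightarrow> (\<And>x. 0 \<le> f x \<and> f x \<le> 1) \<Longrightarrow>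
      (\<integral>x. f x \<partial>M) = (\<integral>x. f x \<partial>N)"
  shows "M = N"
proof -
  have lim: "(\<lambda>k. \<integral>x. max 0 (1 - real k * infdist x F) \<partial>P) \<longlonglongrightarrow> measure P F"
    if "closed F" "F \<noteq> {}" and P: "P \<in> borel_probs" for F :: "'a set" and P
  proof -
    interpret prob_space P using P by (simp add: borel_probs_def)
    have [measurable_cong]: "sets P = sets borel" using P by (simp add: borel_probs_def)
    have [measurable]: "F \<in> sets borel" "(\<lambda>x. infdist x F) \<in> borel_measurable borel"
      using \<open>closed F\<close> by (auto intro!: borel_measurable_continuous_onI continuous_intros)
    have "(\<lambda>k. \<integral>x. max 0 (1 - real k * infdist x F) \<partial>P) \<longlonglongrightarrow> (\<integral>x. indicator F x \<partial>P)"
    proof (rule integral_dominated_convergence[where w="\<lambda>_. 1"])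
      show "AE x in P. (\<lambda>k. max 0 (1 - real k * infdist x F)) \<longlonglongrightarrow> indicator F x"
      proof (rule AE_I2)
        fix x
        show "(\<lambda>k. max 0 (1 - real k * infdist x F)) \<longlonglongrightarrow> indicator F x"
        proof (cases "x \<in> F")
          case True then show ?thesis by simp
        next
          case False
          then have "infdist x F > 0"
            using that infdist_nonneg[of x F] in_closed_iff_infdist_zero[of F x] by linarith
          then obtain K :: nat where K: "1 < real K * infdist x F"
            using reals_Archimedean3 by blast
          have "max 0 (1 - real k * infdist x F) = 0" if "k \<ge> K" for k
            using K mult_right_mono[of "real K" "real k" "infdist x F"] that infdist_nonneg[of x F] by auto
          then have "\<forall>\<^sub>F k in sequentially. max 0 (1 - real k * infdist x F) = 0"
            using eventually_sequentially by blast
          then show ?thesis using False by (simp add: tendsto_eventually)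
        qed
      qed
    qed (auto simp: infdist_nonneg)
    then show ?thesis by (simp add: \<open>sets P = sets borel\<close>)
  qed
  have closed: "emeasure M F = emeasure N F" if F: "closed F" for F
  proof (cases "F = {}")
    case False
    interpret M: prob_space M using M by (simp add: borel_probs_def)
    interpret N: prob_space N using N by (simp add: borel_probs_def)
    have "(\<integral>x. max 0 (1 - real k * infdist x F) \<partial>M) = (\<integral>x. max 0 (1 - real k * infdist x F) \<partial>N)" for k
      by (intro eq continuous_intros) (auto simp: infdist_nonneg)
    then have "measure M F = measure N F"
      using lim[OF F False M] lim[OF F False N] LIMSEQ_unique by simp
    then show ?thesis by (simp add: M.emeasure_eq_measure N.emeasure_eq_measure)
  qed simp
  show ?thesis
  proof (rule measure_eqI_generator_eq[where E="Collect closed" and \<Omega>=UNIV and A="\<lambda>_. UNIV"])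
    show "Int_stable (Collect closed :: 'a set set)" by (auto simp: Int_stable_def)
    have "sets (borel :: 'a measure) = sigma_sets UNIV (Collect closed)"
      unfolding borel_eq_closed by simp
    then show "sets M = sigma_sets UNIV (Collect closed)" "sets N = sigma_sets UNIV (Collect closed)"
      using M N by (auto simp: borel_probs_def)
    show "emeasure M UNIV \<noteq> \<infinity>"
      using M prob_space.emeasure_space_1 by (fastforce simp: borel_probs_def dest: sets_eq_imp_space_eq)
  qed (auto simp: closed)
qed

section \<open>Couplings\<close>

lemma couplings_integral_marginals:
  fixes f g :: "'a::metric_space \<Rightarrow> real"
  assumes cpt: "compact (UNIV :: 'a set)" and \<pi>: "\<pi> \<in> couplings \<mu> \<nu>"
    and f: "continuous_on UNIV f" and g: "continuous_on UNIV g"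
  shows "(\<integral>z. f (fst z) + g (snd z) \<partial>\<pi>) = (\<integral>x. f x \<partial>\<mu>) + (\<integral>y. g y \<partial>\<nu>)"
proof -
  have \<pi>P: "\<pi> \<in> borel_probs" and d: "distr \<pi> borel fst = \<mu>" "distr \<pi> borel snd = \<nu>"
    using \<pi> by (auto simp: couplings_def)
  have cpt2: "compact (UNIV :: ('a \<times> 'a) set)"
    using compact_Times[OF cpt cpt] by simp
  have [measurable_cong]: "sets \<pi> = sets borel" using \<pi>P by (simp add: borel_probs_def)
  have [measurable]: "fst \<in> borel_measurable (borel :: ('a \<times> 'a) measure)"
      "snd \<in> borel_measurable (borel :: ('a \<times> 'a) measure)"
    by (auto intro!: borel_measurable_continuous_onI continuous_intros)
  have [measurable]: "f \<in> borel_measurable borel" "g \<in> borel_measurable borel"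
    using f g by (auto intro: borel_measurable_continuous_onI)
  have cf: "continuous_on UNIV (\<lambda>z :: 'a \<times> 'a. f (fst z))"
    by (rule continuous_on_compose2[OF f]) (auto intro!: continuous_intros)
  have cg: "continuous_on UNIV (\<lambda>z :: 'a \<times> 'a. g (snd z))"
    by (rule continuous_on_compose2[OF g]) (auto intro!: continuous_intros)
  have "(\<integral>z. f (fst z) + g (snd z) \<partial>\<pi>) = (\<integral>z. f (fst z) \<partial>\<pi>) + (\<integral>z. g (snd z) \<partial>\<pi>)"
    using compact_space_continuous_integrable[OF cpt2 \<pi>P] cf cg by simp
  also have "(\<integral>z. f (fst z) \<partial>\<pi>) = (\<integral>x. f x \<partial>\<mu>)"
    unfolding d(1)[symmetric] by (subst integral_distr) auto
  also have "(\<integral>z. g (snd z) \<partial>\<pi>) = (\<integral>y. g y \<partial>\<nu>)"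
    unfolding d(2)[symmetric] by (subst integral_distr) auto
  finally show ?thesis .
qed

text \<open>
  The easy half of Kantorovich-Rubinstein duality: integrate \<open>f x - f y \<le> d(x, y)\<close> against the coupling.
\<close>
lemma lipschitz_dual_le_transport:
  fixes f :: "'a::metric_space \<Rightarrow> real"
  assumes cpt: "compact (UNIV :: 'a set)" and f: "1-lipschitz_on UNIV f" and \<pi>: "\<pi> \<in> couplings \<mu> \<nu>"
  shows "(\<integral>x. f x \<partial>\<mu>) - (\<integral>x. f x \<partial>\<nu>) \<le> (\<integral>z. dist (fst z) (snd z) \<partial>\<pi>)"
proof -
  have cpt2: "compact (UNIV :: ('a \<times> 'a) set)"
    using compact_Times[OF cpt cpt] by simp
  have \<pi>P: "\<pi> \<in> borel_probs" using \<pi> by (simp add: couplings_def)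
  have f_cont: "continuous_on UNIV f" using f by (rule lipschitz_on_continuous_on)
  have "(\<integral>x. f x \<partial>\<mu>) - (\<integral>x. f x \<partial>\<nu>) = (\<integral>z. f (fst z) + - f (snd z) \<partial>\<pi>)"
    by (subst couplings_integral_marginals[OF cpt \<pi>]) (auto intro!: f_cont continuous_intros)
  also have "\<dots> \<le> (\<integral>z. dist (fst z) (snd z) \<partial>\<pi>)"
  proof (rule integral_mono)
    show "integrable \<pi> (\<lambda>z. f (fst z) + - f (snd z))"
      by (intro compact_space_continuous_integrable[OF cpt2 \<pi>P] continuous_intros
          continuous_on_compose2[OF f_cont]) auto
    show "integrable \<pi> (\<lambda>z. dist (fst z) (snd z))"
      by (intro compact_space_continuous_integrable[OF cpt2 \<pi>P] continuous_intros)
    show "f (fst z) + - f (snd z) \<le> dist (fst z) (snd z)" for z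
      using lipschitz_onD[OF f, of "fst z" "snd z"] by (auto simp: dist_real_def)
  qed
  finally show ?thesis .
qed

text \<open>
  Marginals survive weak limits: a continuous function of one coordinate has the same integral under
  all the couplings, hence also under their limit, and continuous functions determine a measure.
\<close>
lemma couplings_weak_limit:
  fixes \<pi> :: "nat \<Rightarrow> ('a::metric_space \<times> 'a) measure"
  assumes cpt: "compact (UNIV :: 'a set)" and \<mu>: "\<mu> \<in> borel_probs" and \<nu>: "\<nu> \<in> borel_probs"
    and \<pi>: "\<And>n. \<pi> n \<in> couplings \<mu> \<nu>"
  obtains r \<rho> where "strict_mono (r :: nat \<Rightarrow> nat)" "\<rho> \<in> couplings \<mu> \<nu>" "weakly_converges (\<pi> \<circ> r) \<rho>"
proof -
  have cpt2: "compact (UNIV :: ('a \<times> 'a) set)"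
    using compact_Times[OF cpt cpt] by simp
  have \<pi>P: "\<pi> n \<in> borel_probs" for n using \<pi> by (simp add: couplings_def)
  obtain r \<rho> where r: "strict_mono (r :: nat \<Rightarrow> nat)" and \<rho>: "\<rho> \<in> borel_probs"
    and conv: "weakly_converges (\<pi> \<circ> r) \<rho>"
    by (rule compact_space_weak_convergent_subsequence[where M=\<pi>, OF cpt2 \<pi>P])
  have marginal: "distr \<rho> borel p = \<kappa>"
    if p: "continuous_on UNIV p" and \<kappa>: "\<And>n. distr (\<pi> n) borel p = \<kappa>" "\<kappa> \<in> borel_probs" for p :: "'a \<times> 'a \<Rightarrow> 'a" and \<kappa>
  proof (rule borel_probs_eqI_continuous[OF _ \<kappa>(2)])
    have p_meas: "p \<in> borel_measurable borel" using p by (rule borel_measurable_continuous_onI)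
    have push: "(\<integral>x. f x \<partial>distr P borel p) = (\<integral>z. f (p z) \<partial>P)"
      if "P \<in> borel_probs" "continuous_on UNIV f" for P and f :: "'a \<Rightarrow> real"
    proof (rule integral_distr)
      show "p \<in> measurable P borel"
        using that(1) p_meas by (simp add: borel_probs_def cong: measurable_cong_sets)
      show "f \<in> borel_measurable borel" using that(2) by (rule borel_measurable_continuous_onI)
    qed
    show "distr \<rho> borel p \<in> borel_probs"
      using \<rho> p_meas
      by (auto simp: borel_probs_def intro!: prob_space.prob_space_distr cong: measurable_cong_sets)
    fix f :: "'a \<Rightarrow> real" assume f: "continuous_on UNIV f"
    have "(\<lambda>n. \<integral>z. f (p z) \<partial>\<pi> (r n)) \<longlonglongrightarrow> (\<integral>z. f (p z) \<partial>\<rho>)"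
      using conv continuous_on_compose2[OF f p] by (simp add: weakly_converges_def)
    moreover have "(\<integral>z. f (p z) \<partial>\<pi> (r n)) = (\<integral>x. f x \<partial>\<kappa>)" for n
      using push[OF _ f, of "\<pi> (r n)"] \<pi>[of "r n"] \<kappa>(1)[of "r n"] by (simp add: couplings_def)
    ultimately have "(\<integral>z. f (p z) \<partial>\<rho>) = (\<integral>x. f x \<partial>\<kappa>)"
      by (simp add: LIMSEQ_const_iff)
    then show "(\<integral>x. f x \<partial>distr \<rho> borel p) = (\<integral>x. f x \<partial>\<kappa>)"
      using push[OF \<rho> f] by simp
  qed
  have "\<rho> \<in> couplings \<mu> \<nu>"
    unfolding couplings_def using \<rho> \<pi> \<mu> \<nu>
    by (auto simp: couplings_def intro!: marginal continuous_intros)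
  with r show thesis using conv by (rule that)
qed

section \<open>Entropic plans and potentials\<close>

text \<open>
  Each ball of radius \<open>r\<close> contains one of finitely many balls of radius \<open>r / 2\<close> that cover the space,
  and these have positive mass. Uniformity in the centre is what allows the bound to be integrated.
\<close>
lemma full_support_balls_bounded_below:
  fixes \<mu> :: "'a::metric_space measure"
  assumes cpt: "compact (UNIV :: 'a set)" and \<mu>: "\<mu> \<in> borel_probs" and supp: "measure_supp \<mu> = UNIV"
    and "r > 0"
  obtains m where "m > 0" "\<And>y. m \<le> measure \<mu> (ball y r)"
proof -
  interpret prob_space \<mu> using \<mu> by (simp add: borel_probs_def)
  have sets: "sets \<mu> = sets borel" using \<mu> by (simp add: borel_probs_def)
  obtain k :: "'a set" where k: "finite k" "UNIV \<subseteq> (\<Union>x\<in>k. ball x (r / 2))"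
    using cpt \<open>r > 0\<close> compact_eq_totally_bounded[of "UNIV :: 'a set"] by (meson half_gt_zero)
  then have "k \<noteq> {}" by auto
  have pos: "measure \<mu> (ball x (r / 2)) > 0" for x
  proof -
    have "x \<in> measure_supp \<mu>" using supp by simp
    then have "emeasure \<mu> (ball x (r / 2)) > 0"
      unfolding measure_supp_def using \<open>r > 0\<close> by auto
    then show ?thesis by (simp add: emeasure_eq_measure)
  qed
  show thesis
  proof (rule that[of "Min ((\<lambda>x. measure \<mu> (ball x (r / 2))) ` k)"])
    show "Min ((\<lambda>x. measure \<mu> (ball x (r / 2))) ` k) > 0"
      using k \<open>k \<noteq> {}\<close> pos by simp
    fix y
    obtain x where x: "x \<in> k" "dist x y < r / 2" using k(2) by fastforce
    have "Min ((\<lambda>x. measure \<mu> (ball x (r / 2))) ` k) \<le> measure \<mu> (ball x (r / 2))"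
      using k x by simp
    also have "\<dots> \<le> measure \<mu> (ball y r)"
    proof (rule finite_measure_mono)
      have "dist y w < r" if "dist x w < r / 2" for w
        using that x(2) dist_triangle3[of y w x] by linarith
      then show "ball x (r / 2) \<subseteq> ball y r" by auto
    qed (simp add: sets)
    finally show "Min ((\<lambda>x. measure \<mu> (ball x (r / 2))) ` k) \<le> measure \<mu> (ball y r)" .
  qed
qed

text \<open>
  The optimality system of entropic optimal transport (the Schroedinger system) at a fixed inverse
  temperature \<open>b\<close>.
\<close>
locale entropic_potentials =
  fixes \<mu> \<nu> :: "'a::metric_space measure" and b :: real and u v :: "'a \<Rightarrow> real"
  assumes cpt: "compact (UNIV :: 'a set)"
    and \<mu>: "\<mu> \<in> borel_probs" and \<nu>: "\<nu> \<in> borel_probs"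
    and b_pos: "b > 0"
    and u_cont: "continuous_on UNIV u" and v_cont: "continuous_on UNIV v"
    and marginal_\<mu>: "\<And>y. (\<integral>x. exp (- b * dist x y + u x + v y) \<partial>\<mu>) = 1"
    and marginal_\<nu>: "\<And>x. (\<integral>y. exp (- b * dist x y + u x + v y) \<partial>\<nu>) = 1"
begin

sublocale \<mu>: prob_space \<mu> using \<mu> by (simp add: borel_probs_def)
sublocale \<nu>: prob_space \<nu> using \<nu> by (simp add: borel_probs_def)
sublocale pair_prob_space \<mu> \<nu> ..

lemma sets_marginals[measurable_cong]: "sets \<mu> = sets borel" "sets \<nu> = sets borel"
  using \<mu> \<nu> by (auto simp: borel_probs_def)

lemma sets_product: "sets (\<mu> \<Otimes>\<^sub>M \<nu>) = sets (borel :: ('a \<times> 'a) measure)"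
  using sets_borel_prod_compact_space[OF cpt] sets_marginals by (metis sets_pair_measure_cong)

definition kernel :: "'a \<times> 'a \<Rightarrow> real" where
  "kernel z = exp (- b * dist (fst z) (snd z) + u (fst z) + v (snd z))"

lemma kernel_continuous: "continuous_on UNIV kernel"
  unfolding kernel_def
  by (intro continuous_intros continuous_on_compose2[OF u_cont] continuous_on_compose2[OF v_cont]) auto

lemma kernel_measurable[measurable]: "kernel \<in> borel_measurable (\<mu> \<Otimes>\<^sub>M \<nu>)"
  using borel_measurable_continuous_onI[OF kernel_continuous] measurable_cong_sets sets_product by blast

lemma kernel_integrals:
  "integrable \<mu> (\<lambda>x. kernel (x, y))" "integrable \<nu> (\<lambda>y. kernel (x, y))"
  "(\<integral>x. kernel (x, y) \<partial>\<mu>) = 1" "(\<integral>y. kernel (x, y) \<partial>\<nu>) = 1"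
  "(\<integral>\<^sup>+x. kernel (x, y) \<partial>\<mu>) = 1" "(\<integral>\<^sup>+y. kernel (x, y) \<partial>\<nu>) = 1"
proof -
  show 1: "integrable \<mu> (\<lambda>x. kernel (x, y))" "integrable \<nu> (\<lambda>y. kernel (x, y))"
    by (intro compact_space_continuous_integrable[OF cpt] \<mu> \<nu>
        continuous_on_compose2[OF kernel_continuous]; auto intro!: continuous_intros)+
  show 2: "(\<integral>x. kernel (x, y) \<partial>\<mu>) = 1" "(\<integral>y. kernel (x, y) \<partial>\<nu>) = 1"
    using marginal_\<mu> marginal_\<nu> by (auto simp: kernel_def)
  show "(\<integral>\<^sup>+x. kernel (x, y) \<partial>\<mu>) = 1" "(\<integral>\<^sup>+y. kernel (x, y) \<partial>\<nu>) = 1"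
    using nn_integral_eq_integral[OF 1(1)] nn_integral_eq_integral[OF 1(2)] 2
    by (auto simp: kernel_def)
qed

text \<open>
  Moving \<open>x\<close> to \<open>x'\<close> multiplies the kernel, apart from its factor \<open>exp (u x)\<close>, by at least
  \<open>exp (- b d(x, x'))\<close>; as both \<open>\<nu>\<close>-integrals equal 1, \<open>u\<close> cannot grow faster.
\<close>
lemma potential_lipschitz: "u x' \<le> u x + b * dist x x'"
proof -
  have "exp (u x' - u x - b * dist x x') = (\<integral>y. exp (u x' - u x - b * dist x x') * kernel (x, y) \<partial>\<nu>)"
    using kernel_integrals by simp
  also have "\<dots> \<le> (\<integral>y. kernel (x', y) \<partial>\<nu>)"
  proof (rule integral_mono)
    fix y
    have "b * dist x' y \<le> b * dist x y + b * dist x x'"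
      using b_pos dist_triangle3[of x' y x] by (simp flip: distrib_left)
    then show "exp (u x' - u x - b * dist x x') * kernel (x, y) \<le> kernel (x', y)"
      by (simp add: kernel_def flip: exp_add)
  qed (use kernel_integrals in auto)
  finally show ?thesis using kernel_integrals by simp
qed

text \<open>
  On the ball of radius \<open>r\<close> about \<open>y\<close> the distance term and the oscillation of \<open>u\<close> each cost at
  most \<open>b r\<close>, so the kernel is at least \<open>exp (u y + v y - 2 b r)\<close> there, while its total
  \<open>\<mu>\<close>-integral is 1.
\<close>
lemma potentials_sum_le:
  assumes "m > 0" and m: "m \<le> measure \<mu> (ball y r)"
  shows "u y + v y \<le> 2 * b * r - ln m"
proof -
  have [measurable]: "ball y r \<in> sets \<mu>" by (simp add: sets_marginals)
  have int: "integrable \<mu> (indicator (ball y r) :: 'a \<Rightarrow> real)"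
    by (rule integrable_real_indicator) (auto simp: \<mu>.emeasure_eq_measure)
  have "exp (u y + v y - 2 * b * r) * m \<le> exp (u y + v y - 2 * b * r) * measure \<mu> (ball y r)"
    using m by simp
  also have "\<dots> = (\<integral>x. exp (u y + v y - 2 * b * r) * indicator (ball y r) x \<partial>\<mu>)"
    by simp
  also have "\<dots> \<le> (\<integral>x. kernel (x, y) \<partial>\<mu>)"
  proof (rule integral_mono)
    fix x
    show "exp (u y + v y - 2 * b * r) * indicator (ball y r) x \<le> kernel (x, y)"
    proof (cases "x \<in> ball y r")
      case True
      then have "b * dist x y \<le> b * r" using b_pos by (auto simp: dist_commute)
      then show ?thesis using True potential_lipschitz[of y x] by (simp add: kernel_def)
    qed (simp add: kernel_def)
  qed (use kernel_integrals int in auto)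
  finally have "exp (u y + v y - 2 * b * r) * m \<le> 1" using kernel_integrals by simp
  then have "exp (u y + v y - 2 * b * r) \<le> exp (- ln m)"
    using \<open>m > 0\<close> by (simp add: exp_minus field_simps)
  then show ?thesis by simp
qed

definition plan :: "('a \<times> 'a) measure" where
  "plan = density (\<mu> \<Otimes>\<^sub>M \<nu>) (\<lambda>z. ennreal (kernel z))"

text \<open>
  The two normalisation conditions say exactly that integrating out one variable of the density
  leaves 1.
\<close>
lemma plan_marginals: "distr plan borel fst = \<mu>" "distr plan borel snd = \<nu>"
proof -
  show "distr plan borel fst = \<mu>"
  proof (rule measure_eqI)
    fix A assume "A \<in> sets (distr plan borel fst)"
    then have A[measurable]: "A \<in> sets borel" by simp
    have "emeasure (distr plan borel fst) A = (\<integral>\<^sup>+z. ennreal (kernel z) * indicator A (fst z) \<partial>(\<mu> \<Otimes>\<^sub>M \<nu>))"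
      unfolding plan_def
      by (subst emeasure_distr, measurable, subst emeasure_density)
         (auto intro!: nn_integral_cong split: split_indicator)
    also have "\<dots> = (\<integral>\<^sup>+x. (\<integral>\<^sup>+y. ennreal (kernel (x, y)) * indicator A x \<partial>\<nu>) \<partial>\<mu>)"
      by (subst \<nu>.nn_integral_fst[symmetric]) auto
    also have "\<dots> = (\<integral>\<^sup>+x. indicator A x \<partial>\<mu>)"
      using kernel_integrals by (subst nn_integral_multc) auto
    also have "\<dots> = emeasure \<mu> A" by simp
    finally show "emeasure (distr plan borel fst) A = emeasure \<mu> A" .
  qed (simp add: sets_marginals)
  show "distr plan borel snd = \<nu>"
  proof (rule measure_eqI)
    fix A assume "A \<in> sets (distr plan borel snd)"
    then have A[measurable]: "A \<in> sets borel" by simp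
    have "emeasure (distr plan borel snd) A = (\<integral>\<^sup>+z. ennreal (kernel z) * indicator A (snd z) \<partial>(\<mu> \<Otimes>\<^sub>M \<nu>))"
      unfolding plan_def
      by (subst emeasure_distr, measurable, subst emeasure_density)
         (auto intro!: nn_integral_cong split: split_indicator)
    also have "\<dots> = (\<integral>\<^sup>+y. (\<integral>\<^sup>+x. ennreal (kernel (x, y)) * indicator A y \<partial>\<mu>) \<partial>\<nu>)"
      by (subst nn_integral_snd[symmetric]) auto
    also have "\<dots> = (\<integral>\<^sup>+y. indicator A y \<partial>\<nu>)"
      using kernel_integrals by (subst nn_integral_multc) auto
    also have "\<dots> = emeasure \<nu> A" by simp
    finally show "emeasure (distr plan borel snd) A = emeasure \<nu> A" .
  qed (simp add: sets_marginals)
qed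

lemma plan_coupling: "plan \<in> couplings \<mu> \<nu>"
proof -
  have sets_plan: "sets plan = sets borel" by (simp add: plan_def sets_product)
  have "prob_space plan"
  proof (rule prob_space_distrD)
    show "fst \<in> measurable plan borel" by (simp add: plan_def)
    show "prob_space (distr plan borel fst)" unfolding plan_marginals by (rule \<mu>.prob_space_axioms)
  qed
  with sets_plan show ?thesis by (simp add: couplings_def borel_probs_def plan_marginals)
qed

text \<open>
  The density of the plan is \<open>exp (- h)\<close> for \<open>h = b d - u - v\<close>, and \<open>h exp (- h) \<le> 1\<close>, so \<open>h\<close>
  has plan integral at most 1; the integrals of \<open>u\<close> and \<open>v\<close> depend on the marginals only.
\<close>
lemma plan_cost: "(\<integral>z. dist (fst z) (snd z) \<partial>plan) \<le> ((\<integral>x. u x \<partial>\<mu>) + (\<integral>y. v y \<partial>\<nu>) + 1) / b"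
proof -
  have cpt2: "compact (UNIV :: ('a \<times> 'a) set)"
    using compact_Times[OF cpt cpt] by simp
  have planP: "plan \<in> borel_probs" using plan_coupling by (simp add: couplings_def)
  define h where "h z = b * dist (fst z) (snd z) - (u (fst z) + v (snd z))" for z
  have uv_cont: "continuous_on UNIV (\<lambda>z :: 'a \<times> 'a. u (fst z) + v (snd z))"
    by (intro continuous_intros continuous_on_compose2[OF u_cont] continuous_on_compose2[OF v_cont]) auto
  have d_cont: "continuous_on UNIV (\<lambda>z :: 'a \<times> 'a. dist (fst z) (snd z))"
    by (intro continuous_intros)
  have h_cont: "continuous_on UNIV h"
    unfolding h_def by (intro continuous_intros d_cont uv_cont)
  have h_meas[measurable]: "h \<in> borel_measurable (\<mu> \<Otimes>\<^sub>M \<nu>)"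
    using borel_measurable_continuous_onI[OF h_cont] measurable_cong_sets sets_product by blast
  have prodP: "\<mu> \<Otimes>\<^sub>M \<nu> \<in> borel_probs"
    using sets_product prob_space_axioms by (simp add: borel_probs_def)
  have "(\<integral>z. h z \<partial>plan) = (\<integral>z. kernel z * h z \<partial>(\<mu> \<Otimes>\<^sub>M \<nu>))"
    unfolding plan_def by (subst integral_density) (auto simp: kernel_def)
  also have "\<dots> \<le> (\<integral>z. 1 \<partial>(\<mu> \<Otimes>\<^sub>M \<nu>))"
  proof (rule integral_mono)
    show "integrable (\<mu> \<Otimes>\<^sub>M \<nu>) (\<lambda>z. kernel z * h z)"
      by (intro compact_space_continuous_integrable[OF cpt2 prodP] continuous_intros kernel_continuous h_cont)
    fix z
    have "h z \<le> exp (h z)" using exp_ge_add_one_self[of "h z"] by linarith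
    then have "exp (- h z) * h z \<le> 1" by (simp add: exp_minus field_simps)
    moreover have "kernel z = exp (- h z)" by (simp add: kernel_def h_def)
    ultimately show "kernel z * h z \<le> 1" by simp
  qed auto
  finally have "(\<integral>z. h z \<partial>plan) \<le> 1" by (simp add: prob_space)
  moreover have "(\<integral>z. h z \<partial>plan) = b * (\<integral>z. dist (fst z) (snd z) \<partial>plan) - (\<integral>z. u (fst z) + v (snd z) \<partial>plan)"
    unfolding h_def using compact_space_continuous_integrable[OF cpt2 planP] uv_cont d_cont
    by (subst Bochner_Integration.integral_diff) auto
  ultimately show ?thesis
    using couplings_integral_marginals[OF cpt plan_coupling u_cont v_cont] b_pos
    by (simp add: field_simps)
qed

end

section \<open>The limit of vanishing temperature\<close>

theorem corollary1p2:
  fixes \<mu> \<nu> :: "'a::metric_space measure"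
    and \<phi> \<psi> :: "real \<Rightarrow> 'a \<Rightarrow> real"
    and \<beta> :: "nat \<Rightarrow> real"
    and \<phi>lim :: "'a \<Rightarrow> real"
  assumes "compact (UNIV :: 'a set)"
    and "\<mu> \<in> borel_probs" and "\<nu> \<in> borel_probs"
    and "measure_supp \<mu> = UNIV" and "measure_supp \<nu> = UNIV"
    and "\<And>b. b > 0 \<Longrightarrow> continuous_on UNIV (\<phi> b)"
    and "\<And>b. b > 0 \<Longrightarrow> continuous_on UNIV (\<psi> b)"
    and "\<And>b y. b > 0 \<Longrightarrow> (\<integral>x. exp (- b * dist x y + \<phi> b x + \<psi> b y) \<partial>\<mu>) = 1"
    and "\<And>b x. b > 0 \<Longrightarrow> (\<integral>y. exp (- b * dist x y + \<phi> b x + \<psi> b y) \<partial>\<nu>) = 1"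
    and "\<And>n. \<beta> n > 0"
    and "filterlim \<beta> at_top sequentially"
    and "uniform_limit UNIV (\<lambda>n x. \<phi> (\<beta> n) x / \<beta> n) \<phi>lim sequentially"
  shows "Lip \<phi>lim \<le> 1 \<and>
    transport_cost dist \<mu> \<nu> = (\<integral>x. \<phi>lim x \<partial>\<mu>) - (\<integral>x. \<phi>lim x \<partial>\<nu>)"
proof
  note cpt = assms(1) and \<mu> = assms(2) and \<nu> = assms(3) and \<beta>_pos = assms(10) and unif = assms(12)
  have E: "entropic_potentials \<mu> \<nu> (\<beta> n) (\<phi> (\<beta> n)) (\<psi> (\<beta> n))" for n
    by unfold_locales (use assms in auto)
  interpret E: entropic_potentials \<mu> \<nu> "\<beta> n" "\<phi> (\<beta> n)" "\<psi> (\<beta> n)" for n by (rule E)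
  define F where "F n x = \<phi> (\<beta> n) x / \<beta> n" for n x
  have F_cont: "continuous_on UNIV (F n)" for n
    unfolding F_def using \<beta>_pos[of n] by (intro continuous_intros E.u_cont) auto
  have F_lim: "(\<lambda>n. F n x) \<longlonglongrightarrow> \<phi>lim x" for x
    unfolding F_def using tendsto_uniform_limitI[OF unif] by simp
  have F_lip: "F n x' \<le> F n x + dist x x'" for n x x'
    using E.potential_lipschitz[of n x' x] \<beta>_pos[of n] by (simp add: F_def field_simps)
  have lim_lip: "\<phi>lim x' \<le> \<phi>lim x + dist x x'" for x x'
    by (rule LIMSEQ_le[OF F_lim tendsto_add[OF F_lim tendsto_const]]) (use F_lip in auto)
  have lip: "1-lipschitz_on UNIV \<phi>lim"
  proof (rule lipschitz_onI)
    fix x y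
    show "dist (\<phi>lim x) (\<phi>lim y) \<le> 1 * dist x y"
      using lim_lip[of x y] lim_lip[of y x] by (auto simp: dist_real_def dist_commute abs_le_iff)
  qed simp
  show "Lip \<phi>lim \<le> 1"
    unfolding Lip_def by (rule INF_lower2[of 1]) (use lip in auto)

  obtain r \<rho> where r: "strict_mono (r :: nat \<Rightarrow> nat)" and \<rho>: "\<rho> \<in> couplings \<mu> \<nu>"
    and conv: "weakly_converges (E.plan \<circ> r) \<rho>"
    by (rule couplings_weak_limit[where \<pi>="\<lambda>n. E.plan n", OF cpt \<mu> \<nu> E.plan_coupling])
  let ?d = "\<lambda>z. dist (fst z) (snd z)" and ?D = "(\<integral>x. \<phi>lim x \<partial>\<mu>) - (\<integral>x. \<phi>lim x \<partial>\<nu>)"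

  have F_int: "(\<lambda>n. \<integral>x. F n x \<partial>P) \<longlonglongrightarrow> (\<integral>x. \<phi>lim x \<partial>P)" if P: "P \<in> borel_probs" for P
  proof -
    interpret prob_space P using P by (simp add: borel_probs_def)
    have int: "integrable P (F n)" "integrable P \<phi>lim" for n
      using compact_space_continuous_integrable[OF cpt P] F_cont lipschitz_on_continuous_on[OF lip] by auto
    show ?thesis
    proof (rule tendstoI)
      fix e :: real assume "e > 0"
      then have "\<forall>\<^sub>F n in sequentially. \<forall>x\<in>UNIV. dist (F n x) (\<phi>lim x) < e / 2"
        using uniform_limitD[OF unif, of "e / 2"] by (simp add: F_def)
      then show "\<forall>\<^sub>F n in sequentially. dist (\<integral>x. F n x \<partial>P) (\<integral>x. \<phi>lim x \<partial>P) < e"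
      proof eventually_elim
        case (elim n)
        have "dist (\<integral>x. F n x \<partial>P) (\<integral>x. \<phi>lim x \<partial>P) = \<bar>\<integral>x. F n x - \<phi>lim x \<partial>P\<bar>"
          using int by (simp add: dist_real_def)
        also have "\<dots> \<le> (\<integral>x. \<bar>F n x - \<phi>lim x\<bar> \<partial>P)" by (rule integral_abs_bound)
        also have "\<dots> \<le> (\<integral>x. e / 2 \<partial>P)"
          using elim int by (intro integral_mono integrable_abs Bochner_Integration.integrable_diff)
            (auto simp: dist_real_def less_imp_le)
        finally show ?case using \<open>e > 0\<close> by (simp add: prob_space)
      qed
    qed
  qed

  \<comment> \<open>At a fixed radius \<open>e\<close> the term \<open>ln m\<close> is constant in \<open>n\<close> and vanishes after division by \<open>\<beta> n\<close>;
    only afterwards is \<open>e\<close> sent to 0.\<close>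
  have cost_le: "(\<integral>z. ?d z \<partial>\<rho>) \<le> ?D + 2 * e" if "e > 0" for e
  proof -
    obtain m where m: "m > 0" "\<And>y. m \<le> measure \<mu> (ball y e)"
      using full_support_balls_bounded_below[OF cpt \<mu> assms(4) \<open>e > 0\<close>] by metis
    have bound: "(\<integral>z. ?d z \<partial>E.plan n) \<le> (\<integral>x. F n x \<partial>\<mu>) - (\<integral>x. F n x \<partial>\<nu>) + 2 * e + (1 - ln m) / \<beta> n" for n
    proof -
      let ?u = "\<phi> (\<beta> n)" and ?v = "\<psi> (\<beta> n)"
      have iu: "integrable \<nu> ?u" and iv: "integrable \<nu> ?v"
        using compact_space_continuous_integrable[OF cpt \<nu>] E.u_cont E.v_cont by auto
      have "(\<integral>y. ?v y \<partial>\<nu>) \<le> (\<integral>y. 2 * \<beta> n * e - ln m - ?u y \<partial>\<nu>)"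
      proof (rule integral_mono)
        show "?v y \<le> 2 * \<beta> n * e - ln m - ?u y" for y
          using E.potentials_sum_le[OF m(1) m(2), of n y] by simp
      qed (use iu iv in auto)
      also have "\<dots> = 2 * \<beta> n * e - ln m - (\<integral>y. ?u y \<partial>\<nu>)"
        using iu by (simp add: E.\<nu>.prob_space)
      finally have "(\<integral>z. ?d z \<partial>E.plan n) \<le> ((\<integral>x. ?u x \<partial>\<mu>) + (2 * \<beta> n * e - ln m - (\<integral>y. ?u y \<partial>\<nu>)) + 1) / \<beta> n"
        using E.plan_cost[of n] \<beta>_pos[of n] by (smt (verit) divide_right_mono)
      also have "\<dots> = (\<integral>x. F n x \<partial>\<mu>) - (\<integral>x. F n x \<partial>\<nu>) + 2 * e + (1 - ln m) / \<beta> n"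
        using \<beta>_pos[of n] by (simp add: F_def field_simps)
      finally show ?thesis .
    qed
    have "(\<lambda>n. (\<integral>x. F n x \<partial>\<mu>) - (\<integral>x. F n x \<partial>\<nu>) + 2 * e + (1 - ln m) / \<beta> n) \<longlonglongrightarrow> ?D + 2 * e + 0"
      by (intro tendsto_intros F_int \<mu> \<nu> tendsto_divide_0[OF tendsto_const]
          filterlim_at_top_imp_at_infinity assms(11))
    from LIMSEQ_subseq_LIMSEQ[OF this r]
    have "(\<lambda>n. (\<integral>x. F (r n) x \<partial>\<mu>) - (\<integral>x. F (r n) x \<partial>\<nu>) + 2 * e + (1 - ln m) / \<beta> (r n)) \<longlonglongrightarrow> ?D + 2 * e"
      by (simp add: comp_def)
    moreover have "(\<lambda>n. \<integral>z. ?d z \<partial>E.plan (r n)) \<longlonglongrightarrow> (\<integral>z. ?d z \<partial>\<rho>)"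
      using conv by (simp add: weakly_converges_def continuous_intros)
    ultimately show ?thesis using bound by (intro LIMSEQ_le) auto
  qed
  have "(\<integral>z. ?d z \<partial>\<rho>) \<le> ?D"
  proof (rule field_le_epsilon)
    fix e :: real assume "e > 0"
    then show "(\<integral>z. ?d z \<partial>\<rho>) \<le> ?D + e" using cost_le[of "e / 2"] by simp
  qed
  then have "(\<integral>z. ?d z \<partial>\<rho>) = ?D"
    using lipschitz_dual_le_transport[OF cpt lip \<rho>] by simp
  then show "transport_cost dist \<mu> \<nu> = ?D"
    unfolding transport_cost_def using \<rho> lipschitz_dual_le_transport[OF cpt lip]
    by (intro Least_equality) (auto intro: rev_image_eqI)
qed

end
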